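(* Let $X=Y$ and $S$ be completely regular topological spaces, and let $\pi^{+}, \pi^{-}\in\mathcal M_{+}(X\times S)$ be concentrated on disjoint Borel sets $A^{+}, A^{-}\subset X\times S$ respectively (i.e. $A^{+}\cap A^{-}=\emptyset$, $\pi^{+}((X\times S)\setminus A^{+})=0$, $\pi^{-}((X\times S)\setminus A^{-})=0$). Let $\mu^{+} = Pr_X (\pi^{+})$, $\nu^{+} = Pr_S (\pi^{+})$, $\pi = \pi^{+} + \pi^{-}$, and let $h\colon X\times S\to\mathbb R$ be given by $h=1$ on $A^{+}$ and $h=0$ elsewhere. Put $$K_h(\mu^{+}, \nu^{+}; \pi)=\inf\Bigl\{\int_{X \times S} h(x, s)\, \tau(dx \, ds):\ \tau\in\Pi(\mu^{+}, \nu^{+}; \pi)\Bigr\}.$$ Then the maximum of $\sigma^{+}(X\times S)$ over all admissible pairs $(\sigma^{+},\sigma^{-})$ is equal to $$\pi^{+}(X \times S) - K_h(\mu^{+}, \nu^{+}; \pi).$$ Moreover, an admissible pair $(\sigma^{+}, \sigma^{-})$ is optimal (maximizes $\sigma^{+}(X\times S)$ among all admissible pairs) if and only if the measure $\tau = \pi^{+} - \sigma^{+} + \sigma^{-}$ is an optimal solution of the Kantorovich problem with density constraints, i.e. $\tau\in\Pi(\mu^{+}, \nu^{+}; \pi)$ and $\int_{X\times S} h\,d\tau=K_h(\mu^{+}, \nu^{+}; \pi)$.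
   Context: For a topological space $Z$, $\mathcal M_{+}(Z)$ denotes the set of finite nonnegative Radon measures on $Z$: Borel measures $\mu$ such that for every Borel set $B$ and every $\varepsilon>0$ there is a compact set $K\subset B$ with $\mu(B\setminus K)<\varepsilon$. $Pr_X(\sigma)$, $Pr_S(\sigma)$ denote the projections (image measures) of a measure $\sigma$ on $X\times S$. Inequalities between measures are setwise on Borel sets. $Y$ is a copy of $X$, so measures on $Y\times S$ are identified with measures on $X\times S$. A pair $(\sigma^{+},\sigma^{-})$ of measures in $\mathcal M_{+}(X\times S)$ is called admissible if $\sigma^{+}\le\pi^{+}$, $\sigma^{-}\le\pi^{-}$, $Pr_X(\sigma^{+})=Pr_X(\sigma^{-})$ and $Pr_S(\sigma^{+})=Pr_S(\sigma^{-})$. $\Pi(\mu^{+}, \nu^{+}; \pi)$ is the set of all $\tau\in\mathcal M_{+}(X\times S)$ with $Pr_X(\tau)=\mu^{+}$, $Pr_S(\tau)=\nu^{+}$ and $\tau\le\pi$. *)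

theory Defs
  imports "HOL-Analysis.Analysis"
begin

text \<open>
  Finite nonnegative Radon measures on a topological space. A compact set need not be Borel when the
  space is not Hausdorff, so measurability of \<open>K\<close> is demanded explicitly: otherwise
  \<open>measure \<mu> (B - K)\<close> could be the dummy value 0 of a non-measurable set.
\<close>

definition radon_measures :: "'a::topological_space measure set" where
  "radon_measures = {\<mu>. sets \<mu> = sets borel \<and> finite_measure \<mu> \<and>
     (\<forall>B\<in>sets borel. \<forall>\<epsilon>>0. \<exists>K\<in>sets borel. compact K \<and> K \<subseteq> B \<and> measure \<mu> (B - K) < \<epsilon>)}"

text \<open>
  Here \<open>borel\<close> on the product type is the Borel algebra of the product topology, which may be
  strictly larger than the product \<open>borel \<Otimes>\<^sub>M borel\<close>.
\<close>

definition Pr_X :: "('x::topological_space \<times> 's::topological_space) measure \<Rightarrow> 'x measure" where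
  "Pr_X \<sigma> = distr \<sigma> borel fst"

definition Pr_S :: "('x::topological_space \<times> 's::topological_space) measure \<Rightarrow> 's measure" where
  "Pr_S \<sigma> = distr \<sigma> borel snd"

definition setwise_le :: "'a::topological_space measure \<Rightarrow> 'a measure \<Rightarrow> bool" where
  "setwise_le \<sigma> \<rho> \<longleftrightarrow> (\<forall>B\<in>sets borel. emeasure \<sigma> B \<le> emeasure \<rho> B)"

text \<open>Setwise sum of two measures, the counterpart of the library's \<^const>\<open>diff_measure\<close>.\<close>

definition add_measure :: "'a measure \<Rightarrow> 'a measure \<Rightarrow> 'a measure" where
  "add_measure M N = measure_of (space M) (sets M) (\<lambda>A. emeasure M A + emeasure N A)"

lemma
  shows space_add_measure [simp]: "space (add_measure M N) = space M"
    and sets_add_measure [simp]: "sets (add_measure M N) = sets M"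
  by (auto simp: add_measure_def)

lemma emeasure_add_measure:
  assumes sets_eq: "sets M = sets N" and A: "A \<in> sets M"
  shows "emeasure (add_measure M N) A = emeasure M A + emeasure N A"
  unfolding add_measure_def
proof (rule emeasure_measure_of_sigma)
  show "sigma_algebra (space M) (sets M)" ..
  show "positive (sets M) (\<lambda>A. emeasure M A + emeasure N A)"
    by (simp add: positive_def)
  show "countably_additive (sets M) (\<lambda>A. emeasure M A + emeasure N A)"
  proof (rule countably_additiveI)
    fix F :: "nat \<Rightarrow> _" assume F: "range F \<subseteq> sets M" "disjoint_family F"
    then show "(\<Sum>i. emeasure M (F i) + emeasure N (F i)) =
        emeasure M (\<Union>i. F i) + emeasure N (\<Union>i. F i)"
      by (simp add: suminf_add [symmetric] suminf_emeasure sets_eq)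
  qed
qed fact

text \<open>The parameters are the bounds \<open>\<pi>\<^sup>+\<close> and \<open>\<pi>\<^sup>-\<close>.\<close>

definition admissible ::
  "('x::topological_space \<times> 's::topological_space) measure \<Rightarrow> ('x \<times> 's) measure \<Rightarrow>
   ('x \<times> 's) measure \<times> ('x \<times> 's) measure \<Rightarrow> bool" where
  "admissible \<pi>p \<pi>m = (\<lambda>(\<sigma>p, \<sigma>m).
     \<sigma>p \<in> radon_measures \<and> \<sigma>m \<in> radon_measures \<and>
     setwise_le \<sigma>p \<pi>p \<and> setwise_le \<sigma>m \<pi>m \<and>
     Pr_X \<sigma>p = Pr_X \<sigma>m \<and> Pr_S \<sigma>p = Pr_S \<sigma>m)"

definition optimal_pair ::
  "('x::topological_space \<times> 's::topological_space) measure \<Rightarrow> ('x \<times> 's) measure \<Rightarrow>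
   ('x \<times> 's) measure \<times> ('x \<times> 's) measure \<Rightarrow> bool" where
  "optimal_pair \<pi>p \<pi>m = is_arg_max (\<lambda>(\<sigma>p, \<sigma>m). measure \<sigma>p UNIV) (admissible \<pi>p \<pi>m)"

definition constrained_plans ::
  "'x::topological_space measure \<Rightarrow> 's::topological_space measure \<Rightarrow> ('x \<times> 's) measure \<Rightarrow>
   ('x \<times> 's) measure set" where
  "constrained_plans \<mu> \<nu> \<pi> =
     {\<tau> \<in> radon_measures. Pr_X \<tau> = \<mu> \<and> Pr_S \<tau> = \<nu> \<and> setwise_le \<tau> \<pi>}"

text \<open>
  A real-valued infimum: the intended meaning requires the set of plans to be nonempty and the
  integrals to exist and be bounded below, as they are for bounded Borel \<open>h\<close>.
\<close>

definition kantorovich_inf ::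
  "('x::topological_space \<times> 's::topological_space \<Rightarrow> real) \<Rightarrow> 'x measure \<Rightarrow> 's measure \<Rightarrow>
   ('x \<times> 's) measure \<Rightarrow> real" where
  "kantorovich_inf h \<mu> \<nu> \<pi> = (INF \<tau>\<in>constrained_plans \<mu> \<nu> \<pi>. \<integral>z. h z \<partial>\<tau>)"

definition kantorovich_optimal ::
  "('x::topological_space \<times> 's::topological_space \<Rightarrow> real) \<Rightarrow> 'x measure \<Rightarrow> 's measure \<Rightarrow>
   ('x \<times> 's) measure \<Rightarrow> ('x \<times> 's) measure \<Rightarrow> bool" where
  "kantorovich_optimal h \<mu> \<nu> \<pi> \<tau> \<longleftrightarrow>
     \<tau> \<in> constrained_plans \<mu> \<nu> \<pi> \<and> (\<integral>z. h z \<partial>\<tau>) = kantorovich_inf h \<mu> \<nu> \<pi>"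

end

theory Submission
  imports Defs
begin

text \<open>
  The map \<open>(\<sigma>\<^sup>+, \<sigma>\<^sup>-) \<mapsto> \<tau> = \<pi>\<^sup>+ - \<sigma>\<^sup>+ + \<sigma>\<^sup>-\<close> sends admissible pairs to plans, and
  \<open>\<tau>(A\<^sup>+) = \<pi>\<^sup>+(X \<times> S) - \<sigma>\<^sup>+(X \<times> S)\<close>. Conversely, a plan \<open>\<tau>\<close> gives the admissible pair
  \<open>\<sigma>\<^sup>+ = \<pi>\<^sup>+ - \<tau>|A\<^sup>+\<close>, \<open>\<sigma>\<^sup>- = \<tau>|(X \<times> S - A\<^sup>+)\<close>. So maximising \<open>\<sigma>\<^sup>+(X \<times> S)\<close> amounts to
  minimising \<open>\<integral>h d\<tau> = \<tau>(A\<^sup>+)\<close>. The minimum is attained because plans are exactly the measures with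
  a density \<open>0 \<le> f \<le> 1\<close> relative to \<open>\<pi>\<close> that obeys linear constraints, a bounded closed convex
  subset of \<open>L\<^sup>2(\<pi>)\<close>, and because a measure below a Radon measure is Radon.
\<close>

section \<open>Radon measures and the setwise order\<close>

lemma radon_measuresD:
  assumes "\<mu> \<in> radon_measures"
  shows "finite_measure \<mu>" "sets \<mu> = sets borel" "space \<mu> = UNIV"
  using assms sets_eq_imp_space_eq[of \<mu> borel] by (auto simp: radon_measures_def)

lemma radon_measures_inner_compact:
  assumes "\<mu> \<in> radon_measures" "B \<in> sets borel" "\<epsilon> > 0"
  obtains K where "K \<in> sets borel" "compact K" "K \<subseteq> B" "measure \<mu> (B - K) < \<epsilon>"
proof -
  have "\<forall>B\<in>sets borel. \<forall>\<epsilon>>0. \<exists>K\<in>sets borel. compact K \<and> K \<subseteq> B \<and> measure \<mu> (B - K) < \<epsilon>"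
    using assms(1) by (simp add: radon_measures_def)
  from this[rule_format, OF assms(2,3)] show ?thesis
    using that by auto
qed

text \<open>\<open>emeasure\<close> takes the default value 0 off the measurable sets, so the order
  passes from Borel sets to arbitrary sets. Later uses are spared a measurability condition on
  \<open>B\<close>.\<close>

lemma setwise_leD:
  assumes "setwise_le \<sigma> \<rho>" "sets \<sigma> = sets borel"
  shows "emeasure \<sigma> B \<le> emeasure \<rho> B"
  using assms by (cases "B \<in> sets borel") (auto simp: setwise_le_def emeasure_notin_sets)

lemma setwise_le_iff_measure_le:
  assumes "finite_measure \<sigma>" "finite_measure \<rho>"
  shows "setwise_le \<sigma> \<rho> \<longleftrightarrow> (\<forall>B\<in>sets borel. measure \<sigma> B \<le> measure \<rho> B)"
  using assms by (simp add: setwise_le_def finite_measure.emeasure_eq_measure)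

lemma finite_measure_setwise_le:
  assumes "setwise_le \<sigma> \<rho>" "finite_measure \<rho>" "sets \<sigma> = sets borel"
  shows "finite_measure \<sigma>"
proof
  have "emeasure \<sigma> (space \<sigma>) \<le> emeasure \<rho> (space \<sigma>)"
    using assms by (intro setwise_leD)
  also have "\<dots> < \<infinity>"
    using assms(2) by (simp add: finite_measure.emeasure_eq_measure)
  finally show "emeasure \<sigma> (space \<sigma>) \<noteq> \<infinity>" by simp
qed

text \<open>A compact set that fills \<open>B\<close> up to \<open>\<epsilon>\<close> for
  \<open>\<rho>\<close> does so for \<open>\<sigma>\<close>. Inner regularity of the densities,
  differences and restrictions built later is obtained from this, through domination by a Radon
  measure.\<close>

lemma radon_measures_setwise_le:
  assumes \<rho>: "\<rho> \<in> radon_measures" and le: "setwise_le \<sigma> \<rho>" and sets: "sets \<sigma> = sets borel"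
  shows "\<sigma> \<in> radon_measures"
proof -
  have fin: "finite_measure \<sigma>"
    using finite_measure_setwise_le[OF le radon_measuresD(1)[OF \<rho>] sets] .
  have "\<exists>K\<in>sets borel. compact K \<and> K \<subseteq> B \<and> measure \<sigma> (B - K) < \<epsilon>"
    if B: "B \<in> sets borel" "\<epsilon> > 0" for B and \<epsilon> :: real
  proof -
    obtain K where K: "K \<in> sets borel" "compact K" "K \<subseteq> B" "measure \<rho> (B - K) < \<epsilon>"
      by (rule radon_measures_inner_compact[OF \<rho> B])
    have "measure \<sigma> (B - K) \<le> measure \<rho> (B - K)"
      using le setwise_le_iff_measure_le[OF fin radon_measuresD(1)[OF \<rho>]]
        sets.Diff[OF B(1) K(1)] by simp
    then show ?thesis
      using K by (intro bexI[of _ K]) auto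
  qed
  then show ?thesis
    using fin sets by (auto simp: radon_measures_def)
qed

section \<open>Sums and differences of finite measures\<close>

text \<open>The set \<open>A\<close> is arbitrary: off the measurable sets every term is 0 by
  default, so the identity for \<open>measure\<close> rewrites with no side condition on
  \<open>A\<close>.\<close>

lemma
  assumes fin: "finite_measure \<mu>" "finite_measure \<nu>" and sets: "sets \<mu> = sets \<nu>"
  shows finite_measure_add_measure: "finite_measure (add_measure \<mu> \<nu>)"
    and measure_add_measure: "measure (add_measure \<mu> \<nu>) A = measure \<mu> A + measure \<nu> A"
proof -
  interpret \<mu>: finite_measure \<mu> by fact
  interpret \<nu>: finite_measure \<nu> by fact
  have *: "emeasure (add_measure \<mu> \<nu>) A = emeasure \<mu> A + emeasure \<nu> A" for A
    using emeasure_add_measure[OF sets, of A] sets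
    by (cases "A \<in> sets \<mu>") (auto simp: emeasure_notin_sets)
  then show "finite_measure (add_measure \<mu> \<nu>)"
    by (intro finite_measureI) (simp add: \<mu>.emeasure_eq_measure \<nu>.emeasure_eq_measure)
  show "measure (add_measure \<mu> \<nu>) A = measure \<mu> A + measure \<nu> A"
    unfolding measure_def * by (simp add: \<mu>.emeasure_eq_measure \<nu>.emeasure_eq_measure enn2real_plus)
qed

text \<open>Subtraction in \<open>ennreal\<close> is truncated at 0; the domination
  \<open>le\<close> makes it agree with subtraction of reals.\<close>

lemma
  assumes fin: "finite_measure \<mu>" "finite_measure \<nu>" and sets: "sets \<mu> = sets \<nu>"
    and le: "\<And>A. A \<in> sets \<mu> \<Longrightarrow> emeasure \<nu> A \<le> emeasure \<mu> A"
  shows finite_measure_diff_measure: "finite_measure (diff_measure \<mu> \<nu>)"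
    and measure_diff_measure: "measure (diff_measure \<mu> \<nu>) A = measure \<mu> A - measure \<nu> A"
proof -
  interpret \<mu>: finite_measure \<mu> by fact
  interpret \<nu>: finite_measure \<nu> by fact
  have *: "emeasure (diff_measure \<mu> \<nu>) A = emeasure \<mu> A - emeasure \<nu> A" for A
    using emeasure_diff_measure[OF fin sets le, of A] sets
    by (cases "A \<in> sets \<mu>") (auto simp: emeasure_notin_sets)
  then show "finite_measure (diff_measure \<mu> \<nu>)"
    by (intro finite_measureI) (simp add: \<mu>.emeasure_eq_measure \<nu>.emeasure_eq_measure ennreal_minus)
  have "measure \<nu> A \<le> measure \<mu> A"
    using le[of A] sets
    by (cases "A \<in> sets \<mu>") (auto simp: measure_notin_sets \<mu>.emeasure_eq_measure \<nu>.emeasure_eq_measure)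
  then show "measure (diff_measure \<mu> \<nu>) A = measure \<mu> A - measure \<nu> A"
    unfolding measure_def * by (simp add: \<mu>.emeasure_eq_measure \<nu>.emeasure_eq_measure ennreal_minus)
qed

text \<open>If \<open>K\<close> fills \<open>B\<close> up to \<open>\<epsilon> / 2\<close> for
  \<open>\<mu>\<close> and \<open>L\<close> does so for \<open>\<nu>\<close>, then
  \<open>K \<union> L\<close> fills it up to \<open>\<epsilon>\<close> for the sum.\<close>

lemma radon_measures_add_measure:
  assumes \<mu>: "\<mu> \<in> radon_measures" and \<nu>: "\<nu> \<in> radon_measures"
  shows "add_measure \<mu> \<nu> \<in> radon_measures"
proof -
  interpret \<mu>: finite_measure \<mu> using \<mu> by (rule radon_measuresD)
  interpret \<nu>: finite_measure \<nu> using \<nu> by (rule radon_measuresD)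
  note sets = radon_measuresD(2)[OF \<mu>] radon_measuresD(2)[OF \<nu>]
  have add: "measure (add_measure \<mu> \<nu>) A = measure \<mu> A + measure \<nu> A" for A
    using sets by (intro measure_add_measure \<mu>.finite_measure_axioms \<nu>.finite_measure_axioms) simp
  have "\<exists>K\<in>sets borel. compact K \<and> K \<subseteq> B \<and> measure (add_measure \<mu> \<nu>) (B - K) < \<epsilon>"
    if B: "B \<in> sets borel" and \<epsilon>: "\<epsilon> > 0" for B and \<epsilon> :: real
  proof -
    obtain K where K: "K \<in> sets borel" "compact K" "K \<subseteq> B" "measure \<mu> (B - K) < \<epsilon> / 2"
      by (rule radon_measures_inner_compact[OF \<mu> B half_gt_zero[OF \<epsilon>]])
    obtain L where L: "L \<in> sets borel" "compact L" "L \<subseteq> B" "measure \<nu> (B - L) < \<epsilon> / 2"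
      by (rule radon_measures_inner_compact[OF \<nu> B half_gt_zero[OF \<epsilon>]])
    have "measure \<mu> (B - (K \<union> L)) \<le> measure \<mu> (B - K)" "measure \<nu> (B - (K \<union> L)) \<le> measure \<nu> (B - L)"
      using B K L sets by (auto intro!: \<mu>.finite_measure_mono \<nu>.finite_measure_mono)
    then show ?thesis
      using K L by (intro bexI[of _ "K \<union> L"]) (auto simp: add intro: compact_Un)
  qed
  then show ?thesis
    using finite_measure_add_measure[of \<mu> \<nu>] \<mu>.finite_measure_axioms \<nu>.finite_measure_axioms sets
    by (auto simp: radon_measures_def)
qed

section \<open>Marginals and cylinder sets\<close>

text \<open>The algebra is that of the product topology, not the product of two Borel algebras, so
  measurability of the projections is drawn from their continuity.\<close>

lemma fst_measurable_borel: "fst \<in> borel_measurable (borel :: ('x::topological_space \<times> 's::topological_space) measure)"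
  by (intro borel_measurable_continuous_onI continuous_on_fst continuous_on_id)

lemma snd_measurable_borel: "snd \<in> borel_measurable (borel :: ('x::topological_space \<times> 's::topological_space) measure)"
  by (intro borel_measurable_continuous_onI continuous_on_snd continuous_on_id)

lemma distr_eq_iff_measure:
  assumes fin: "finite_measure \<sigma>" "finite_measure \<rho>"
    and f: "f \<in> measurable \<sigma> N" "f \<in> measurable \<rho> N"
  shows "distr \<sigma> N f = distr \<rho> N f \<longleftrightarrow>
    (\<forall>B\<in>sets N. measure \<sigma> (f -` B \<inter> space \<sigma>) = measure \<rho> (f -` B \<inter> space \<rho>))"
proof
  assume "distr \<sigma> N f = distr \<rho> N f"
  then show "\<forall>B\<in>sets N. measure \<sigma> (f -` B \<inter> space \<sigma>) = measure \<rho> (f -` B \<inter> space \<rho>)"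
    using f by (metis measure_distr)
next
  assume "\<forall>B\<in>sets N. measure \<sigma> (f -` B \<inter> space \<sigma>) = measure \<rho> (f -` B \<inter> space \<rho>)"
  then show "distr \<sigma> N f = distr \<rho> N f"
    using f fin by (intro measure_eqI) (simp_all add: emeasure_distr finite_measure.emeasure_eq_measure)
qed

text \<open>Equality of marginals becomes a family of real equations, one for each cylinder. In this
  form it is linear in the measure and passes through sums, differences, midpoints and
  limits.\<close>

lemma
  fixes \<sigma> \<rho> :: "('x::topological_space \<times> 's::topological_space) measure"
  assumes fin: "finite_measure \<sigma>" "finite_measure \<rho>"
    and sets: "sets \<sigma> = sets borel" "sets \<rho> = sets borel"
  shows Pr_X_eq_iff: "Pr_X \<sigma> = Pr_X \<rho> \<longleftrightarrow>
      (\<forall>B\<in>sets borel. measure \<sigma> (fst -` B) = measure \<rho> (fst -` B))"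
    and Pr_S_eq_iff: "Pr_S \<sigma> = Pr_S \<rho> \<longleftrightarrow>
      (\<forall>B\<in>sets borel. measure \<sigma> (snd -` B) = measure \<rho> (snd -` B))"
proof -
  have sp: "space \<sigma> = UNIV" "space \<rho> = UNIV"
    using sets[THEN sets_eq_imp_space_eq] by auto
  have "fst \<in> measurable \<sigma> borel" "fst \<in> measurable \<rho> borel"
    "snd \<in> measurable \<sigma> borel" "snd \<in> measurable \<rho> borel"
    using fst_measurable_borel snd_measurable_borel sets by (auto cong: measurable_cong_sets)
  then show "Pr_X \<sigma> = Pr_X \<rho> \<longleftrightarrow>
      (\<forall>B\<in>sets borel. measure \<sigma> (fst -` B) = measure \<rho> (fst -` B))"
    and "Pr_S \<sigma> = Pr_S \<rho> \<longleftrightarrow>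
      (\<forall>B\<in>sets borel. measure \<sigma> (snd -` B) = measure \<rho> (snd -` B))"
    unfolding Pr_X_def Pr_S_def using fin by (simp_all add: distr_eq_iff_measure sp)
qed

section \<open>Densities with values in the unit interval\<close>

text \<open>Domination gives absolute continuity, hence a density \<open>g\<close>. It exceeds 1
  only on a null set, since otherwise \<open>N\<close> would exceed \<open>M\<close> on the set
  where \<open>1 < g x\<close>.\<close>

lemma bounded_Radon_Nikodym:
  assumes M: "finite_measure M" and sets: "sets N = sets M"
    and le: "\<And>A. A \<in> sets M \<Longrightarrow> emeasure N A \<le> emeasure M A"
  shows "\<exists>f\<in>borel_measurable M. (\<forall>x. f x \<in> {0..1::real}) \<and> density M (\<lambda>x. ennreal (f x)) = N"
proof -
  interpret finite_measure M by fact
  have "absolutely_continuous M N"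
    unfolding absolutely_continuous_def
  proof
    fix A assume "A \<in> null_sets M"
    then show "A \<in> null_sets N"
      using le[of A] sets by (auto simp: null_sets_def)
  qed
  then obtain g where g[measurable]: "g \<in> borel_measurable M" and N: "density M g = N"
    using Radon_Nikodym[OF _ sets] by blast
  define A where "A = {x \<in> space M. 1 < g x}"
  have [measurable]: "A \<in> sets M" unfolding A_def by measurable
  have ae: "AE x in M. g x \<le> 1"
  proof -
    have 1: "(\<integral>\<^sup>+x. g x * indicator A x \<partial>M) \<le> emeasure M A"
      using le[of A] by (simp add: N[symmetric] emeasure_density)
    \<comment> \<open>On \<open>A\<close> the truncated difference is the genuine
      \<open>g x - 1\<close>, and off \<open>A\<close> it is 0. Its integral is \<open>N\<close> of
      \<open>A\<close> minus \<open>M\<close> of \<open>A\<close>, which is 0 by domination, so the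
      integrand vanishes almost everywhere.\<close>
    have "(\<integral>\<^sup>+x. g x * indicator A x - indicator A x \<partial>M)
        = (\<integral>\<^sup>+x. g x * indicator A x \<partial>M) - (\<integral>\<^sup>+x. indicator A x \<partial>M)"
    proof (rule nn_integral_diff)
      show "(\<integral>\<^sup>+x. indicator A x \<partial>M) \<noteq> \<infinity>"
        by (simp add: emeasure_eq_measure)
      show "AE x in M. indicator A x \<le> g x * indicator A x"
        by (rule AE_I2) (auto simp: A_def indicator_def)
    qed measurable
    also have "\<dots> = 0"
      using 1 by (auto simp: diff_eq_0_iff_ennreal emeasure_eq_measure less_top[symmetric] top_unique)
    finally have "AE x in M. g x * indicator A x - indicator A x = 0"
      by (subst (asm) nn_integral_0_iff_AE) auto
    then show ?thesis
      using AE_space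
    proof eventually_elim
      case (elim x)
      show ?case
      proof (rule ccontr)
        assume "\<not> g x \<le> 1"
        then have "x \<in> A" using elim by (simp add: A_def)
        then have "g x - 1 = 0" using elim by simp
        then show False using ennreal_minus_eq_0[of "g x" 1] \<open>\<not> g x \<le> 1\<close> by blast
      qed
    qed
  qed
  \<comment> \<open>Truncation alters \<open>g\<close> only on a null set, hence leaves the measure
    unchanged, and secures real values in the unit interval at every point.\<close>
  define f where "f x = enn2real (min (g x) 1)" for x
  have f_eq: "ennreal (f x) = min (g x) 1" for x
    unfolding f_def by (rule ennreal_enn2real) (simp add: min_less_iff_disj)
  have [measurable]: "f \<in> borel_measurable M" unfolding f_def by measurable
  have "density M (\<lambda>x. ennreal (f x)) = density M g"
  proof (rule density_cong)
    show "AE x in M. ennreal (f x) = g x"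
      using ae by eventually_elim (simp only: f_eq min_absorb1)
  qed measurable
  moreover have "f x \<in> {0..1}" for x
    by (auto simp: f_def intro!: enn2real_leI)
  ultimately show ?thesis
    using N by (intro bexI[of _ f]) auto
qed

section \<open>Minimising a linear functional over a convex set of functions\<close>

text \<open>The direct method, with a minimising sequence chosen so that it converges. Convexity
  enters through midpoints, and closedness through almost everywhere limits, because a sequence that
  is Cauchy in mean has an almost everywhere Cauchy subsequence.\<close>

lemma exists_min_convex_unit_interval_functions:
  fixes C :: "('a \<Rightarrow> real) set" and \<phi> :: "'a \<Rightarrow> real"
  assumes M: "finite_measure M" and \<phi>: "integrable M \<phi>" and "C \<noteq> {}"
    and meas: "\<And>f. f \<in> C \<Longrightarrow> f \<in> borel_measurable M"
    and unit: "\<And>f x. f \<in> C \<Longrightarrow> f x \<in> {0..1}"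
    and midpoint: "\<And>f g. f \<in> C \<Longrightarrow> g \<in> C \<Longrightarrow> (\<lambda>x. (f x + g x) / 2) \<in> C"
    and closed: "\<And>u g. (\<And>n. u n \<in> C) \<Longrightarrow> g \<in> borel_measurable M \<Longrightarrow> (\<And>x. g x \<in> {0..1}) \<Longrightarrow>
      (AE x in M. (\<lambda>n. u n x) \<longlonglongrightarrow> g x) \<Longrightarrow> g \<in> C"
  shows "\<exists>f\<in>C. \<forall>g\<in>C. (\<integral>x. f x * \<phi> x \<partial>M) \<le> (\<integral>x. g x * \<phi> x \<partial>M)"
proof -
  interpret finite_measure M by fact
  define I where "I f = (\<integral>x. f x * \<phi> x \<partial>M)" for f :: "'a \<Rightarrow> real"
  \<comment> \<open>Nearly minimal norm elements of nearly optimal sets are Cauchy in mean square, by the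
    parallelogram law. This replaces weak compactness of the unit ball.\<close>
  define Q where "Q f = (\<integral>x. (f x)\<^sup>2 \<partial>M)" for f :: "'a \<Rightarrow> real"
  have meas\<phi>[measurable]: "\<phi> \<in> borel_measurable M"
    using \<phi> by simp
  have f_int: "integrable M f" if "f \<in> C" for f
    using that meas unit by (intro integrable_const_bound[where B = 1]) auto
  have I_int: "integrable M (\<lambda>x. f x * \<phi> x)" if "f \<in> C" for f
  proof (rule Bochner_Integration.integrable_bound[OF \<phi>])
    show "(\<lambda>x. f x * \<phi> x) \<in> borel_measurable M"
      using meas[OF that] by measurable
    show "AE x in M. norm (f x * \<phi> x) \<le> norm (\<phi> x)"
      using unit[OF that] by (auto simp: abs_mult intro!: mult_left_le_one_le AE_I2)
  qed
  have Q_int: "integrable M (\<lambda>x. f x * g x)" if "f \<in> C" "g \<in> C" for f g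
  proof (rule integrable_const_bound[where B = 1])
    show "(\<lambda>x. f x * g x) \<in> borel_measurable M"
      using meas[OF that(1)] meas[OF that(2)] by measurable
    show "AE x in M. norm (f x * g x) \<le> 1"
      using unit[OF that(1)] unit[OF that(2)] by (auto simp: abs_mult intro!: mult_le_one AE_I2)
  qed
  have Q_nonneg: "0 \<le> Q f" for f
    unfolding Q_def by simp
  have Q_le: "Q f \<le> measure M (space M)" if "f \<in> C" for f
  proof -
    have "Q f \<le> (\<integral>x. 1 \<partial>M)"
      unfolding Q_def using Q_int[OF that that] unit[OF that]
      by (intro integral_mono) (auto simp: power2_eq_square intro!: mult_le_one)
    then show ?thesis by simp
  qed
  have I_bdd: "bdd_below (I ` C)"
  proof (rule bdd_belowI2)
    fix f assume f: "f \<in> C"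
    have "(\<integral>x. - \<bar>\<phi> x\<bar> \<partial>M) \<le> I f"
      unfolding I_def
    proof (rule integral_mono)
      fix x
      have "\<bar>f x * \<phi> x\<bar> \<le> \<bar>\<phi> x\<bar>"
        using unit[OF f, of x] by (auto simp: abs_mult intro!: mult_left_le_one_le)
      then show "- \<bar>\<phi> x\<bar> \<le> f x * \<phi> x" by linarith
    qed (use \<phi> I_int[OF f] in auto)
    then show "(\<integral>x. - \<bar>\<phi> x\<bar> \<partial>M) \<le> I f" .
  qed
  define m where "m = Inf (I ` C)"
  have m_le: "m \<le> I f" if "f \<in> C" for f
    unfolding m_def using I_bdd that by (intro cINF_lower)
  \<comment> \<open>The near-minimisers of \<open>I\<close>: nonempty sets that shrink with
    \<open>n\<close> and are closed under midpoints, as \<open>I\<close> is linear.\<close>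
  define D where "D n = {f \<in> C. I f \<le> m + 1 / real (Suc n)}" for n
  have D_ne: "D n \<noteq> {}" for n
  proof -
    have "Inf (I ` C) < m + 1 / real (Suc n)"
      unfolding m_def by simp
    then obtain f where "f \<in> C" "I f < m + 1 / real (Suc n)"
      using cINF_less_iff[OF \<open>C \<noteq> {}\<close> I_bdd] by auto
    then show ?thesis unfolding D_def by auto
  qed
  have D_mono: "D k \<subseteq> D n" if "n \<le> k" for n k
  proof -
    have "1 / real (Suc k) \<le> 1 / real (Suc n)"
      using that by (intro divide_left_mono) auto
    then show ?thesis unfolding D_def by auto
  qed
  have D_mid: "(\<lambda>x. (f x + g x) / 2) \<in> D n" if "f \<in> D n" "g \<in> D n" for f g n
  proof -
    have fg: "f \<in> C" "g \<in> C" using that by (auto simp: D_def)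
    have "I (\<lambda>x. (f x + g x) / 2) = (I f + I g) / 2"
      unfolding I_def using I_int[OF fg(1)] I_int[OF fg(2)]
      by (simp add: distrib_right)
    then show ?thesis
      using that midpoint[OF fg] by (auto simp: D_def)
  qed
  have Q_bdd: "bdd_below (Q ` D n)" for n
    by (rule bdd_belowI2[OF Q_nonneg])
  \<comment> \<open>The least squared norm over \<open>D n\<close>. It grows as \<open>D n\<close>
    shrinks and is bounded by the total mass, so it converges; this is what forces the chosen
    sequence to be Cauchy.\<close>
  define d where "d n = Inf (Q ` D n)" for n
  have d_le: "d n \<le> Q f" if "f \<in> D n" for f n
    unfolding d_def using Q_bdd that by (intro cINF_lower)
  have d_mono: "d n \<le> d k" if "n \<le> k" for n k
    unfolding d_def using D_ne D_mono[OF that] Q_bdd by (intro cINF_superset_mono) auto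
  have d_bdd: "d n \<le> measure M (space M)" for n
    using D_ne[of n] d_le Q_le by (force simp: D_def)
  have bdd_d: "bdd_above (range d)" by (rule bdd_aboveI2[OF d_bdd])
  define l where "l = (SUP n. d n)"
  have d_lim: "d \<longlonglongrightarrow> l"
    unfolding l_def using d_mono by (intro LIMSEQ_incseq_SUP bdd_d) (auto simp: incseq_def)
  have d_le_l: "d n \<le> l" for n
    unfolding l_def by (rule cSUP_upper[OF _ bdd_d]) simp
  have "\<exists>f\<in>D n. Q f < d n + 1 / real (Suc n)" for n
  proof -
    have "Inf (Q ` D n) < d n + 1 / real (Suc n)"
      unfolding d_def by simp
    then show ?thesis
      using cINF_less_iff[OF D_ne Q_bdd] by auto
  qed
  then obtain f where f: "\<And>n. f n \<in> D n" "\<And>n. Q (f n) < d n + 1 / real (Suc n)"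
    by metis
  have fC: "f n \<in> C" for n using f(1)[of n] by (simp add: D_def)
  have [measurable]: "f n \<in> borel_measurable M" for n
    using meas[OF fC] .
  define e where "e n = 2 * (l - d n) + 4 / real (Suc n)" for n
  have e_lim: "e \<longlonglongrightarrow> 0"
  proof -
    have "(\<lambda>n. 2 * (l - d n) + 4 * (1 / real (Suc n))) \<longlonglongrightarrow> 2 * (l - l) + 4 * 0"
      by (intro tendsto_intros d_lim LIMSEQ_Suc[OF lim_1_over_n])
    then show ?thesis unfolding e_def by simp
  qed
  \<comment> \<open>Both functions lie in \<open>D n\<close>, hence so does their midpoint
    \<open>g\<close>, and \<open>Q g\<close> is at least \<open>d n\<close>. The parallelogram law
    then bounds the distance by the excess of the two squared norms over \<open>d n\<close>.\<close>
  have diff_sq: "(\<integral>x. (f n x - f k x)\<^sup>2 \<partial>M) \<le> e n" if "n \<le> k" for n k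
  proof -
    define g where "g x = (f n x + f k x) / 2" for x
    have fk: "f k \<in> D n" using f(1)[of k] D_mono[OF that] by auto
    have g: "g \<in> D n" unfolding g_def using f(1) fk by (rule D_mid)
    then have gC: "g \<in> C" by (simp add: D_def)
    have "(\<integral>x. (f n x - f k x)\<^sup>2 \<partial>M) =
        (\<integral>x. 2 * (f n x * f n x) + 2 * (f k x * f k x) - 4 * (g x * g x) \<partial>M)"
      by (rule Bochner_Integration.integral_cong) (auto simp: g_def power2_eq_square algebra_simps)
    also have "\<dots> = 2 * Q (f n) + 2 * Q (f k) - 4 * Q g"
      unfolding Q_def power2_eq_square
      using Q_int[OF fC[of n] fC[of n]] Q_int[OF fC[of k] fC[of k]] Q_int[OF gC gC]
      by simp
    also have "\<dots> \<le> 2 * (d n + 1 / real (Suc n)) + 2 * (l + 1 / real (Suc n)) - 4 * d n"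
    proof -
      have "1 / real (Suc k) \<le> 1 / real (Suc n)"
        using that by (intro divide_left_mono) auto
      then have "Q (f k) \<le> l + 1 / real (Suc n)"
        using f(2)[of k] d_le_l[of k] by linarith
      then have "2 * Q (f k) \<le> 2 * (l + 1 / real (Suc n))"
        by (rule mult_left_mono) simp
      moreover have "2 * Q (f n) \<le> 2 * (d n + 1 / real (Suc n))"
        using f(2)[of n] by (intro mult_left_mono) auto
      ultimately show ?thesis
        using d_le[OF g] by (intro diff_mono add_mono; simp)
    qed
    also have "\<dots> = e n" by (simp add: e_def)
    finally show ?thesis .
  qed
  have diff_int: "integrable M (\<lambda>x. f n x - f k x)" for n k
    using f_int[OF fC] by auto
  have diff_sq_int: "integrable M (\<lambda>x. (f n x - f k x)\<^sup>2)" for n k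
  proof (rule integrable_const_bound[where B = 1])
    show "AE x in M. norm ((f n x - f k x)\<^sup>2) \<le> 1"
    proof (rule AE_I2)
      fix x
      have "\<bar>f n x - f k x\<bar> \<le> 1"
        using unit[OF fC[of n], of x] unit[OF fC[of k], of x] by auto
      then show "norm ((f n x - f k x)\<^sup>2) \<le> 1" by (simp add: abs_square_le_1)
    qed
  qed measurable
  have Cauchy_L1: "\<exists>N. \<forall>n\<ge>N. \<forall>k\<ge>N. (\<integral>x. norm (f n x - f k x) \<partial>M) < \<epsilon>" if "\<epsilon> > 0" for \<epsilon>
  proof -
    \<comment> \<open>The added 1 keeps \<open>B\<close> positive even when \<open>M\<close> has
      total mass 0.\<close>
    define B where "B = measure M (space M) + 1"
    have "B > 0" unfolding B_def by (simp add: add_nonneg_pos)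
    define \<delta> where "\<delta> = \<epsilon> / (2 * B)"
    have "\<delta> > 0" using that \<open>B > 0\<close> by (simp add: \<delta>_def)
    have \<delta>B: "\<delta> * measure M (space M) < \<epsilon> / 2"
    proof -
      have "\<delta> * measure M (space M) < \<delta> * B" using \<open>\<delta> > 0\<close> by (simp add: B_def)
      also have "\<dots> = \<epsilon> / 2" using \<open>B > 0\<close> by (simp add: \<delta>_def)
      finally show ?thesis .
    qed
    have "eventually (\<lambda>n. e n < \<delta> * (\<epsilon> / 2)) sequentially"
      using e_lim \<open>\<delta> > 0\<close> that by (intro order_tendstoD) auto
    then obtain N where N: "\<And>n. n \<ge> N \<Longrightarrow> e n < \<delta> * (\<epsilon> / 2)"
      by (auto simp: eventually_sequentially)
    have *: "(\<integral>x. norm (f n x - f k x) \<partial>M) < \<epsilon>" if "n \<ge> N" "n \<le> k" for n k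
    proof -
      \<comment> \<open>This trades mean square for mean: a number \<open>t\<close> is at most
        \<open>\<delta>\<close> or at most \<open>t\<^sup>2 / \<delta>\<close>, and the constant
        \<open>\<delta>\<close> contributes little because \<open>M\<close> is finite.\<close>
      have "(\<integral>x. norm (f n x - f k x) \<partial>M) \<le> (\<integral>x. \<delta> + (f n x - f k x)\<^sup>2 / \<delta> \<partial>M)"
      proof (rule integral_mono)
        fix x
        define t where "t = \<bar>f n x - f k x\<bar>"
        have "0 \<le> t * \<delta>" using \<open>\<delta> > 0\<close> by (simp add: t_def)
        then have "t * \<delta> \<le> \<delta> * \<delta> + t * t"
          using sum_squares_bound[of t \<delta>] by (simp add: power2_eq_square)
        then have "t \<le> (\<delta> * \<delta> + t * t) / \<delta>"
          using \<open>\<delta> > 0\<close> by (simp add: pos_le_divide_eq)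
        also have "\<dots> = \<delta> + t\<^sup>2 / \<delta>"
          using \<open>\<delta> > 0\<close> by (simp add: add_divide_distrib power2_eq_square)
        finally have "t \<le> \<delta> + t\<^sup>2 / \<delta>" .
        then show "norm (f n x - f k x) \<le> \<delta> + (f n x - f k x)\<^sup>2 / \<delta>"
          by (simp add: t_def)
      qed (use diff_int diff_sq_int in auto)
      also have "\<dots> = \<delta> * measure M (space M) + (\<integral>x. (f n x - f k x)\<^sup>2 \<partial>M) / \<delta>"
        using diff_sq_int by simp
      also have "\<dots> \<le> \<delta> * measure M (space M) + e n / \<delta>"
        using diff_sq[OF that(2)] \<open>\<delta> > 0\<close> by (simp add: divide_right_mono)
      also have "\<dots> < \<epsilon> / 2 + \<epsilon> / 2"
        using \<delta>B N[OF that(1)] \<open>\<delta> > 0\<close>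
        by (intro add_strict_mono) (simp_all add: pos_divide_less_eq mult.commute)
      finally show ?thesis by simp
    qed
    show ?thesis
    proof (intro exI allI impI)
      fix n k assume "n \<ge> N" "k \<ge> N"
      then show "(\<integral>x. norm (f n x - f k x) \<partial>M) < \<epsilon>"
        using *[of n k] *[of k n] by (cases "n \<le> k") (auto simp: abs_minus_commute)
    qed
  qed
  obtain r :: "nat \<Rightarrow> nat" where r: "strict_mono r" "AE x in M. Cauchy (\<lambda>i. f (r i) x)"
    using cauchy_L1_AE_cauchy_subseq[of M f] Cauchy_L1 f_int[OF fC] by metis
  \<comment> \<open>The value 0 at the exceptional points keeps \<open>g\<close> in the unit
    interval everywhere, as \<open>closed\<close> demands.\<close>
  define g where "g x = (if Cauchy (\<lambda>i. f (r i) x) then lim (\<lambda>i. f (r i) x) else 0)" for x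
  have g_meas[measurable]: "g \<in> borel_measurable M"
    unfolding g_def by measurable
  have Cauchy_lim: "(\<lambda>i. f (r i) x) \<longlonglongrightarrow> g x" if "Cauchy (\<lambda>i. f (r i) x)" for x
    using that by (simp add: g_def Cauchy_convergent_iff convergent_LIMSEQ_iff)
  have g_unit: "g x \<in> {0..1}" for x
  proof (cases "Cauchy (\<lambda>i. f (r i) x)")
    case True
    show ?thesis
      by (rule Lim_in_closed_set[OF _ _ _ Cauchy_lim[OF True]]) (use unit[OF fC] in auto)
  qed (simp add: g_def)
  have g_lim: "AE x in M. (\<lambda>n. f (r n) x) \<longlonglongrightarrow> g x"
    using r(2) by eventually_elim (rule Cauchy_lim)
  have gC: "g \<in> C"
    by (rule closed[OF _ g_meas g_unit g_lim]) (rule fC)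
  have "(\<lambda>n. I (f (r n))) \<longlonglongrightarrow> I g"
    unfolding I_def
  proof (rule integral_dominated_convergence[where w = "\<lambda>x. \<bar>\<phi> x\<bar>"])
    show "AE x in M. (\<lambda>n. f (r n) x * \<phi> x) \<longlonglongrightarrow> g x * \<phi> x"
      using g_lim by eventually_elim (intro tendsto_intros)
    show "AE x in M. norm (f (r n) x * \<phi> x) \<le> \<bar>\<phi> x\<bar>" for n
      using unit[OF fC[of "r n"]] by (auto simp: abs_mult intro!: mult_left_le_one_le AE_I2)
  qed (use \<phi> in auto)
  moreover have "(\<lambda>n. m + 1 / real (Suc n)) \<longlonglongrightarrow> m + 0"
    by (intro tendsto_intros LIMSEQ_Suc[OF lim_1_over_n])
  \<comment> \<open>A strictly increasing \<open>r\<close> satisfies \<open>n \<le> r n\<close>, so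
    the subsequence is at least as close to optimal.\<close>
  moreover have "I (f (r n)) \<le> m + 1 / real (Suc n)" for n
  proof -
    have "f (r n) \<in> D n" using f(1)[of "r n"] D_mono[OF seq_suble[OF r(1), of n]] by auto
    then show ?thesis by (simp add: D_def)
  qed
  ultimately have "I g \<le> m"
    by (auto intro: LIMSEQ_le)
  then show ?thesis
    using gC m_le unfolding I_def by (auto intro: order_trans)
qed

section \<open>Existence of an optimal plan\<close>

text \<open>Passing to densities relative to \<open>\<pi>\<close> reduces the claim to
  \<open>exists_min_convex_unit_interval_functions\<close> with \<open>\<phi>\<close> equal to
  \<open>h\<close>.\<close>

lemma constrained_plan_minimiser_exists:
  fixes \<pi> :: "('x::topological_space \<times> 's::topological_space) measure" and h :: "'x \<times> 's \<Rightarrow> real"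
  assumes \<pi>: "\<pi> \<in> radon_measures" and h: "integrable \<pi> h"
    and ne: "constrained_plans \<mu> \<nu> \<pi> \<noteq> {}"
  shows "\<exists>\<tau>\<in>constrained_plans \<mu> \<nu> \<pi>. \<forall>\<tau>'\<in>constrained_plans \<mu> \<nu> \<pi>. (\<integral>z. h z \<partial>\<tau>) \<le> (\<integral>z. h z \<partial>\<tau>')"
proof -
  interpret finite_measure \<pi> using \<pi> by (rule radon_measuresD)
  have [measurable_cong]: "sets \<pi> = sets borel" using \<pi> by (rule radon_measuresD)
  note sets = this
  have h_meas[measurable]: "h \<in> borel_measurable \<pi>" using h by simp
  \<comment> \<open>A reference plan: its marginals are \<open>\<mu>\<close> and
    \<open>\<nu>\<close>, so the marginal conditions can be stated through the numbers
    \<open>measure \<tau>\<^sub>0 E\<close>.\<close>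
  obtain \<tau>\<^sub>0 where \<tau>\<^sub>0: "\<tau>\<^sub>0 \<in> constrained_plans \<mu> \<nu> \<pi>" using ne by blast
  \<comment> \<open>The cylinders over Borel sets, on which the marginal conditions are linear constraints.\<close>
  define \<E> :: "('x \<times> 's) set set" where
    "\<E> = (\<lambda>B. fst -` B) ` sets borel \<union> (\<lambda>B. snd -` B) ` sets borel"
  have \<E>[measurable]: "E \<in> sets borel" if "E \<in> \<E>" for E
    using that measurable_sets[OF fst_measurable_borel] measurable_sets[OF snd_measurable_borel]
    by (auto simp: \<E>_def)
  let ?dens = "\<lambda>f. density \<pi> (\<lambda>z. ennreal (f z))"
  define C where "C = {f \<in> borel_measurable \<pi>. (\<forall>z. f z \<in> {0..1}) \<and>
    (\<forall>E\<in>\<E>. (\<integral>z. f z * indicator E z \<partial>\<pi>) = measure \<tau>\<^sub>0 E)}"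
  have C_int: "integrable \<pi> (\<lambda>z. f z * indicator E z)"
    if "f \<in> borel_measurable \<pi>" "\<forall>z. f z \<in> {0..1}" "E \<in> sets borel" for f :: "_ \<Rightarrow> real" and E
  proof (rule integrable_const_bound[where B = 1])
    show "AE z in \<pi>. norm (f z * indicator E z) \<le> 1"
      using that(2) by (intro AE_I2) (auto simp: indicator_def)
  qed (use that sets in measurable)
  \<comment> \<open>A density at most 1 gives a measure below \<open>\<pi>\<close>, which is
    therefore Radon; only the cylinder equations remain to be compared.\<close>
  have dens: "?dens f \<in> constrained_plans \<mu> \<nu> \<pi> \<longleftrightarrow> f \<in> C"
    if f[measurable]: "f \<in> borel_measurable \<pi>" and unit: "\<forall>z. f z \<in> {0..1}" for f
  proof -
    have le: "setwise_le (?dens f) \<pi>"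
      unfolding setwise_le_def
    proof
      fix B :: "('x \<times> 's) set" assume "B \<in> sets borel"
      then have [measurable]: "B \<in> sets \<pi>" by (simp add: sets)
      have "(\<integral>\<^sup>+z. ennreal (f z) * indicator B z \<partial>\<pi>) \<le> (\<integral>\<^sup>+z. indicator B z \<partial>\<pi>)"
        using unit by (intro nn_integral_mono) (auto simp: indicator_def)
      then show "emeasure (?dens f) B \<le> emeasure \<pi> B" by (simp add: emeasure_density)
    qed
    have radon: "?dens f \<in> radon_measures"
      using \<pi> le by (rule radon_measures_setwise_le) (simp add: sets)
    have meas: "measure (?dens f) E = (\<integral>z. f z * indicator E z \<partial>\<pi>)" if "E \<in> \<E>" for E
    proof -
      have "E \<in> sets \<pi>" using \<E>[OF that] by (simp add: sets)
      have "measure (?dens f) E = (\<integral>z. indicator E z \<partial>?dens f)"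
        using \<open>E \<in> sets \<pi>\<close> sets_eq_imp_space_eq[OF sets] by simp
      also have "\<dots> = (\<integral>z. f z * indicator E z \<partial>\<pi>)"
        using unit \<open>E \<in> sets \<pi>\<close> by (subst integral_density) auto
      finally show ?thesis .
    qed
    have "?dens f \<in> constrained_plans \<mu> \<nu> \<pi> \<longleftrightarrow> Pr_X (?dens f) = Pr_X \<tau>\<^sub>0 \<and> Pr_S (?dens f) = Pr_S \<tau>\<^sub>0"
      using \<tau>\<^sub>0 radon le by (auto simp: constrained_plans_def)
    also have "\<dots> \<longleftrightarrow> (\<forall>E\<in>\<E>. measure (?dens f) E = measure \<tau>\<^sub>0 E)"
    proof -
      have "\<tau>\<^sub>0 \<in> radon_measures" using \<tau>\<^sub>0 by (simp add: constrained_plans_def)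
      note * = radon[THEN radon_measuresD(1)] this[THEN radon_measuresD(1)]
        radon[THEN radon_measuresD(2)] this[THEN radon_measuresD(2)]
      show ?thesis
        unfolding Pr_X_eq_iff[OF *] Pr_S_eq_iff[OF *] \<E>_def by blast
    qed
    also have "\<dots> \<longleftrightarrow> f \<in> C"
      using meas unit by (simp add: C_def)
    finally show ?thesis .
  qed
  have plan_density: "\<exists>f\<in>C. ?dens f = \<tau>" if "\<tau> \<in> constrained_plans \<mu> \<nu> \<pi>" for \<tau>
  proof -
    have "\<tau> \<in> radon_measures" "setwise_le \<tau> \<pi>" using that by (auto simp: constrained_plans_def)
    then have "\<exists>f\<in>borel_measurable \<pi>. (\<forall>z. f z \<in> {0..1::real}) \<and> ?dens f = \<tau>"
      by (intro bounded_Radon_Nikodym finite_measure_axioms setwise_leD) (auto simp: radon_measuresD sets)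
    then show ?thesis using dens that by metis
  qed
  have integral_dens: "(\<integral>z. h z \<partial>?dens f) = (\<integral>z. f z * h z \<partial>\<pi>)" if "f \<in> C" for f
    using that by (subst integral_density) (auto simp: C_def)
  have "\<exists>f\<in>C. \<forall>g\<in>C. (\<integral>z. f z * h z \<partial>\<pi>) \<le> (\<integral>z. g z * h z \<partial>\<pi>)"
  proof (rule exists_min_convex_unit_interval_functions[OF finite_measure_axioms h])
    show "C \<noteq> {}" using plan_density[OF \<tau>\<^sub>0] by blast
  next
    fix f g assume fg: "f \<in> C" "g \<in> C"
    then have [measurable]: "f \<in> borel_measurable \<pi>" "g \<in> borel_measurable \<pi>" by (auto simp: C_def)
    have "(\<integral>z. (f z + g z) / 2 * indicator E z \<partial>\<pi>) = measure \<tau>\<^sub>0 E" if "E \<in> \<E>" for E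
    proof -
      have "(\<integral>z. (f z + g z) / 2 * indicator E z \<partial>\<pi>)
          = ((\<integral>z. f z * indicator E z \<partial>\<pi>) + (\<integral>z. g z * indicator E z \<partial>\<pi>)) / 2"
        using C_int[OF _ _ \<E>[OF that], of f] C_int[OF _ _ \<E>[OF that], of g] fg
        by (simp add: C_def distrib_right)
      then show ?thesis using fg that by (simp add: C_def)
    qed
    moreover have "(f z + g z) / 2 \<in> {0..1}" for z
    proof -
      have "f z \<in> {0..1}" "g z \<in> {0..1}" using fg unfolding C_def by blast+
      then show ?thesis by auto
    qed
    ultimately show "(\<lambda>z. (f z + g z) / 2) \<in> C"
      by (simp add: C_def)
  next
    fix u g
    assume u: "\<And>n. u n \<in> C" and g: "g \<in> borel_measurable \<pi>" "\<And>z. g z \<in> {0..1}"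
      and lim: "AE z in \<pi>. (\<lambda>n. u n z) \<longlonglongrightarrow> g z"
    have [measurable]: "u n \<in> borel_measurable \<pi>" for n using u by (auto simp: C_def)
    have "(\<integral>z. g z * indicator E z \<partial>\<pi>) = measure \<tau>\<^sub>0 E" if "E \<in> \<E>" for E
    proof -
      have [measurable]: "E \<in> sets \<pi>" using \<E>[OF that] by (simp add: sets)
      \<comment> \<open>The constant 1 dominates and is integrable because \<open>\<pi>\<close> is
        finite. All integrals on the left equal \<open>measure \<tau>\<^sub>0 E\<close>, hence so
        does their limit.\<close>
      have "(\<lambda>n. \<integral>z. u n z * indicator E z \<partial>\<pi>) \<longlonglongrightarrow> (\<integral>z. g z * indicator E z \<partial>\<pi>)"
      proof (rule integral_dominated_convergence[where w = "\<lambda>_. 1"])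
        show "AE z in \<pi>. (\<lambda>n. u n z * indicator E z) \<longlonglongrightarrow> g z * indicator E z"
          using lim by eventually_elim (intro tendsto_intros)
        show "AE z in \<pi>. norm (u n z * indicator E z) \<le> 1" for n
          using u[of n] by (intro AE_I2) (auto simp: C_def indicator_def)
      qed (use g in auto)
      moreover have "(\<integral>z. u n z * indicator E z \<partial>\<pi>) = measure \<tau>\<^sub>0 E" for n
        using u[of n] that by (simp add: C_def)
      ultimately show ?thesis by (simp add: LIMSEQ_const_iff)
    qed
    then show "g \<in> C" using g by (simp add: C_def)
  qed (auto simp: C_def)
  then obtain f where f: "f \<in> C" "\<And>g. g \<in> C \<Longrightarrow> (\<integral>z. f z * h z \<partial>\<pi>) \<le> (\<integral>z. g z * h z \<partial>\<pi>)"
    by blast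
  show ?thesis
  proof (intro bexI ballI)
    show "?dens f \<in> constrained_plans \<mu> \<nu> \<pi>" using f(1) dens by (simp add: C_def)
    fix \<tau>' assume "\<tau>' \<in> constrained_plans \<mu> \<nu> \<pi>"
    then obtain g where "g \<in> C" "?dens g = \<tau>'" using plan_density by blast
    then show "(\<integral>z. h z \<partial>?dens f) \<le> (\<integral>z. h z \<partial>\<tau>')"
      using f integral_dens by metis
  qed
qed

section \<open>Passing between admissible pairs and plans\<close>

text \<open>The marginals of \<open>\<sigma>p\<close> and \<open>\<sigma>m\<close> cancel, which
  leaves those of \<open>\<pi>p\<close>. On \<open>A\<close> the part \<open>\<sigma>m\<close>
  vanishes, while \<open>\<pi>p\<close> and \<open>\<sigma>p\<close> carry all their mass
  there.\<close>

lemma admissible_imp_plan: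
  fixes \<pi>p \<pi>m :: "('x::topological_space \<times> 's::topological_space) measure"
  assumes \<pi>p: "\<pi>p \<in> radon_measures" and \<pi>m: "\<pi>m \<in> radon_measures"
    and A: "A \<in> sets borel" "emeasure \<pi>p (UNIV - A) = 0" "emeasure \<pi>m A = 0"
    and adm: "admissible \<pi>p \<pi>m (\<sigma>p, \<sigma>m)"
  defines "\<tau> \<equiv> add_measure (diff_measure \<pi>p \<sigma>p) \<sigma>m"
  shows "\<tau> \<in> constrained_plans (Pr_X \<pi>p) (Pr_S \<pi>p) (add_measure \<pi>p \<pi>m)"
    and "measure \<tau> A = measure \<pi>p UNIV - measure \<sigma>p UNIV"
proof -
  have \<sigma>p: "\<sigma>p \<in> radon_measures" and \<sigma>m: "\<sigma>m \<in> radon_measures"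
    and le: "setwise_le \<sigma>p \<pi>p" "setwise_le \<sigma>m \<pi>m"
    and Pr: "Pr_X \<sigma>p = Pr_X \<sigma>m" "Pr_S \<sigma>p = Pr_S \<sigma>m"
    using adm by (auto simp: admissible_def)
  note fin = \<pi>p[THEN radon_measuresD(1)] \<pi>m[THEN radon_measuresD(1)]
    \<sigma>p[THEN radon_measuresD(1)] \<sigma>m[THEN radon_measuresD(1)]
  note sets = \<pi>p[THEN radon_measuresD(2)] \<pi>m[THEN radon_measuresD(2)]
    \<sigma>p[THEN radon_measuresD(2)] \<sigma>m[THEN radon_measuresD(2)]
  have diff: "finite_measure (diff_measure \<pi>p \<sigma>p)"
    "measure (diff_measure \<pi>p \<sigma>p) B = measure \<pi>p B - measure \<sigma>p B" for B
    using fin sets setwise_leD[OF le(1)]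
    by (auto intro!: finite_measure_diff_measure measure_diff_measure)
  have \<tau>_fin: "finite_measure \<tau>" and \<tau>_sets: "sets \<tau> = sets borel"
    using fin sets diff by (auto simp: \<tau>_def intro!: finite_measure_add_measure)
  have \<tau>_meas: "measure \<tau> B = measure \<pi>p B - measure \<sigma>p B + measure \<sigma>m B" for B
    using fin sets diff by (simp add: \<tau>_def measure_add_measure)
  have \<sigma>p_le: "measure \<sigma>p B \<le> measure \<pi>p B" and \<sigma>m_le: "measure \<sigma>m B \<le> measure \<pi>m B"
    if "B \<in> sets borel" for B
    using le that fin setwise_le_iff_measure_le by blast+
  have "setwise_le \<tau> (add_measure \<pi>p \<pi>m)"
  proof (subst setwise_le_iff_measure_le[OF \<tau>_fin])
    show "finite_measure (add_measure \<pi>p \<pi>m)"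
      using fin sets by (intro finite_measure_add_measure) auto
    show "\<forall>B\<in>sets borel. measure \<tau> B \<le> measure (add_measure \<pi>p \<pi>m) B"
    proof
      fix B :: "('x \<times> 's) set" assume "B \<in> sets borel"
      then show "measure \<tau> B \<le> measure (add_measure \<pi>p \<pi>m) B"
        using \<sigma>m_le[of B] fin sets by (simp add: \<tau>_meas measure_add_measure add_mono)
    qed
  qed
  moreover have "\<tau> \<in> radon_measures"
    using radon_measures_add_measure[OF \<pi>p \<pi>m] calculation \<tau>_sets by (rule radon_measures_setwise_le)
  moreover have "Pr_X \<tau> = Pr_X \<pi>p" "Pr_S \<tau> = Pr_S \<pi>p"
    using Pr fin sets \<tau>_fin \<tau>_sets by (auto simp: Pr_X_eq_iff Pr_S_eq_iff \<tau>_meas)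
  ultimately show "\<tau> \<in> constrained_plans (Pr_X \<pi>p) (Pr_S \<pi>p) (add_measure \<pi>p \<pi>m)"
    by (simp add: constrained_plans_def)
  have null: "measure \<pi>p (UNIV - A) = 0" "measure \<pi>m A = 0"
    using A by (auto simp: measure_def)
  \<comment> \<open>Null sets of \<open>\<pi>p\<close> and \<open>\<pi>m\<close> are inherited by
    the measures below them.\<close>
  have "measure \<sigma>p (UNIV - A) = 0" "measure \<sigma>m A = 0"
    using \<sigma>p_le[of "UNIV - A"] \<sigma>m_le[of A] A(1) null
    by (auto intro!: antisym measure_nonneg simp: Compl_eq_Diff_UNIV[symmetric])
  moreover have "measure \<rho> A = measure \<rho> UNIV - measure \<rho> (UNIV - A)"
    if "\<rho> \<in> radon_measures" for \<rho>
    using finite_measure.finite_measure_compl[of \<rho> A] radon_measuresD[OF that] A(1) by simp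
  ultimately show "measure \<tau> A = measure \<pi>p UNIV - measure \<sigma>p UNIV"
    using null \<pi>p \<sigma>p by (simp add: \<tau>_meas)
qed

text \<open>Since \<open>\<pi>p\<close> and \<open>\<pi>m\<close> live on complementary sets, the
  single bound on \<open>\<tau>\<close> splits: its part on \<open>A\<close> lies below
  \<open>\<pi>p\<close>, its part off \<open>A\<close> below \<open>\<pi>m\<close>. So the
  difference defining \<open>\<sigma>p\<close> is legitimate and \<open>\<sigma>m\<close> obeys its
  bound.\<close>

lemma plan_imp_admissible:
  fixes \<pi>p \<pi>m :: "('x::topological_space \<times> 's::topological_space) measure"
  assumes \<pi>p: "\<pi>p \<in> radon_measures" and \<pi>m: "\<pi>m \<in> radon_measures"
    and A: "A \<in> sets borel" "emeasure \<pi>p (UNIV - A) = 0" "emeasure \<pi>m A = 0"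
    and plan: "\<tau> \<in> constrained_plans (Pr_X \<pi>p) (Pr_S \<pi>p) (add_measure \<pi>p \<pi>m)"
  defines "\<sigma>p \<equiv> diff_measure \<pi>p (density \<tau> (indicator A))"
    and "\<sigma>m \<equiv> density \<tau> (indicator (UNIV - A))"
  shows "admissible \<pi>p \<pi>m (\<sigma>p, \<sigma>m)"
    and "measure \<sigma>p UNIV = measure \<pi>p UNIV - measure \<tau> A"
proof -
  have \<tau>: "\<tau> \<in> radon_measures" and le: "setwise_le \<tau> (add_measure \<pi>p \<pi>m)"
    and Pr: "Pr_X \<tau> = Pr_X \<pi>p" "Pr_S \<tau> = Pr_S \<pi>p"
    using plan by (auto simp: constrained_plans_def)
  interpret \<pi>p: finite_measure \<pi>p using \<pi>p by (rule radon_measuresD)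
  interpret \<pi>m: finite_measure \<pi>m using \<pi>m by (rule radon_measuresD)
  interpret \<tau>: finite_measure \<tau> using \<tau> by (rule radon_measuresD)
  note fin = \<pi>p.finite_measure_axioms \<pi>m.finite_measure_axioms \<tau>.finite_measure_axioms
  note sets = \<pi>p[THEN radon_measuresD(2)] \<pi>m[THEN radon_measuresD(2)] \<tau>[THEN radon_measuresD(2)]
  have cA: "UNIV - A \<in> sets borel" using A(1) by auto
  have null: "measure \<pi>p (UNIV - A) = 0" "measure \<pi>m A = 0"
    using A by (auto simp: measure_def)
  have \<tau>_le: "measure \<tau> B \<le> measure \<pi>p B + measure \<pi>m B" if "B \<in> sets borel" for B
    using le that fin sets
    by (simp add: setwise_le_iff_measure_le finite_measure_add_measure measure_add_measure)
  have \<tau>_le_p: "measure \<tau> (A \<inter> B) \<le> measure \<pi>p B" if "B \<in> sets borel" for B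
  proof -
    have "measure \<pi>m (A \<inter> B) \<le> measure \<pi>m A" "measure \<pi>p (A \<inter> B) \<le> measure \<pi>p B"
      using A(1) that sets by (auto intro!: \<pi>m.finite_measure_mono \<pi>p.finite_measure_mono)
    then show ?thesis using \<tau>_le[of "A \<inter> B"] A(1) that null by simp
  qed
  have \<tau>_le_m: "measure \<tau> ((UNIV - A) \<inter> B) \<le> measure \<pi>m B" if "B \<in> sets borel" for B
  proof -
    have "measure \<pi>p ((UNIV - A) \<inter> B) \<le> measure \<pi>p (UNIV - A)"
      "measure \<pi>m ((UNIV - A) \<inter> B) \<le> measure \<pi>m B"
      using cA that sets by (auto intro!: \<pi>m.finite_measure_mono \<pi>p.finite_measure_mono)
    then show ?thesis using \<tau>_le[of "(UNIV - A) \<inter> B"] cA that null by simp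
  qed
  let ?\<tau>A = "density \<tau> (indicator A)"
  have \<tau>A: "finite_measure ?\<tau>A" "measure ?\<tau>A B = measure \<tau> (A \<inter> B)"
    and \<sigma>m: "finite_measure \<sigma>m" "measure \<sigma>m B = measure \<tau> ((UNIV - A) \<inter> B)"
    if "B \<in> sets borel" for B
    using A(1) cA that sets
    by (auto simp: \<sigma>m_def measure_restricted simp del: Compl_eq_Diff_UNIV
        intro!: \<tau>.finite_measure_restricted)
  have \<tau>A_le: "emeasure ?\<tau>A B \<le> emeasure \<pi>p B" if "B \<in> sets \<pi>p" for B
    using that \<tau>A[of B] \<tau>_le_p[of B] sets by (simp add: finite_measure.emeasure_eq_measure \<pi>p.emeasure_eq_measure)
  have \<tau>A_fin: "finite_measure ?\<tau>A" and \<sigma>m_fin: "finite_measure \<sigma>m"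
    using \<tau>A(1)[of UNIV] \<sigma>m(1)[of UNIV] by auto
  have \<sigma>m_sets: "sets \<sigma>m = sets borel" and \<sigma>p_sets: "sets \<sigma>p = sets borel"
    using sets by (auto simp: \<sigma>m_def \<sigma>p_def)
  have \<sigma>p_fin: "finite_measure \<sigma>p"
    unfolding \<sigma>p_def using sets \<tau>A_le
    by (intro finite_measure_diff_measure \<pi>p.finite_measure_axioms \<tau>A_fin) auto
  have \<sigma>p: "measure \<sigma>p B = measure \<pi>p B - measure \<tau> (A \<inter> B)" if "B \<in> sets borel" for B
    unfolding \<sigma>p_def using \<tau>A(2)[OF that] sets \<tau>A_le
    by (subst measure_diff_measure) (auto intro: \<tau>A_fin \<pi>p.finite_measure_axioms)
  have "setwise_le \<sigma>p \<pi>p"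
    using \<sigma>p \<sigma>p_fin fin by (simp add: setwise_le_iff_measure_le)
  moreover have "setwise_le \<sigma>m \<pi>m"
    using \<sigma>m(2) \<sigma>m_fin fin \<tau>_le_m by (simp add: setwise_le_iff_measure_le)
  moreover have "\<sigma>p \<in> radon_measures" "\<sigma>m \<in> radon_measures"
    using radon_measures_setwise_le[OF \<pi>p _ \<sigma>p_sets] radon_measures_setwise_le[OF \<pi>m _ \<sigma>m_sets]
      calculation by simp_all
  \<comment> \<open>Where \<open>\<tau>\<close> and \<open>\<pi>p\<close> give \<open>E\<close> the
    same mass, removing the part of \<open>\<tau>\<close> on \<open>A\<close> from
    \<open>\<pi>p\<close> leaves exactly the part of \<open>\<tau>\<close> off \<open>A\<close>.
    Cylinders are such sets, by the marginal conditions on \<open>\<tau>\<close>.\<close>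
  moreover have split: "measure \<sigma>p E = measure \<sigma>m E"
    if E: "E \<in> sets borel" and eq: "measure \<tau> E = measure \<pi>p E" for E
  proof -
    have "measure \<tau> E = measure \<tau> (A \<inter> E) + measure \<tau> ((UNIV - A) \<inter> E)"
      using E A(1) cA sets by (subst \<tau>.finite_measure_Union[symmetric]) (auto intro!: arg_cong[of _ _ "measure \<tau>"])
    then show ?thesis using eq by (simp add: \<sigma>p[OF E] \<sigma>m(2)[OF E])
  qed
  have "Pr_X \<sigma>p = Pr_X \<sigma>m"
    using Pr(1) measurable_sets[OF fst_measurable_borel]
    by (auto simp: Pr_X_eq_iff fin sets \<sigma>p_fin \<sigma>m_fin \<sigma>p_sets \<sigma>m_sets intro!: split)
  moreover have "Pr_S \<sigma>p = Pr_S \<sigma>m"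
    using Pr(2) measurable_sets[OF snd_measurable_borel]
    by (auto simp: Pr_S_eq_iff fin sets \<sigma>p_fin \<sigma>m_fin \<sigma>p_sets \<sigma>m_sets intro!: split)
  ultimately show "admissible \<pi>p \<pi>m (\<sigma>p, \<sigma>m)"
    by (simp add: admissible_def)
  show "measure \<sigma>p UNIV = measure \<pi>p UNIV - measure \<tau> A"
    using \<sigma>p[of UNIV] by simp
qed

section \<open>The maximal mass and the optimal pairs\<close>

theorem theorem4p1:
  fixes \<pi>p \<pi>m \<pi> :: "('x::topological_space \<times> 's::topological_space) measure"
    and Ap Am :: "('x \<times> 's) set"
    and \<mu>p :: "'x measure" and \<nu>p :: "'s measure"
    and h :: "'x \<times> 's \<Rightarrow> real"
  assumes "completely_regular_space (euclidean :: 'x topology)"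
    and "completely_regular_space (euclidean :: 's topology)"
    and "\<pi>p \<in> radon_measures" and "\<pi>m \<in> radon_measures"
    and "Ap \<in> sets borel" and "Am \<in> sets borel" and "Ap \<inter> Am = {}"
    and "emeasure \<pi>p (UNIV - Ap) = 0" and "emeasure \<pi>m (UNIV - Am) = 0"
    and "\<mu>p = Pr_X \<pi>p" and "\<nu>p = Pr_S \<pi>p"
    and "\<pi> = add_measure \<pi>p \<pi>m"
    and "h = (\<lambda>z. if z \<in> Ap then 1 else 0)"
  shows "((\<exists>\<sigma>p \<sigma>m. admissible \<pi>p \<pi>m (\<sigma>p, \<sigma>m) \<and>
             measure \<sigma>p UNIV = measure \<pi>p UNIV - kantorovich_inf h \<mu>p \<nu>p \<pi>) \<and>
          (\<forall>\<sigma>p \<sigma>m. admissible \<pi>p \<pi>m (\<sigma>p, \<sigma>m) \<longrightarrow>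
             measure \<sigma>p UNIV \<le> measure \<pi>p UNIV - kantorovich_inf h \<mu>p \<nu>p \<pi>)) \<and>
         (\<forall>\<sigma>p \<sigma>m. admissible \<pi>p \<pi>m (\<sigma>p, \<sigma>m) \<longrightarrow>
            (optimal_pair \<pi>p \<pi>m (\<sigma>p, \<sigma>m) \<longleftrightarrow>
             kantorovich_optimal h \<mu>p \<nu>p \<pi> (add_measure (diff_measure \<pi>p \<sigma>p) \<sigma>m)))"
proof -
  note \<pi>p = assms(3) and \<pi>m = assms(4) and Ap = assms(5)
  define plans where "plans = constrained_plans \<mu>p \<nu>p \<pi>"
  define K where "K = kantorovich_inf h \<mu>p \<nu>p \<pi>"
  have plans_eq: "plans = constrained_plans (Pr_X \<pi>p) (Pr_S \<pi>p) (add_measure \<pi>p \<pi>m)"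
    using assms by (simp add: plans_def)
  \<comment> \<open>Disjointness places \<open>Ap\<close> in the complement of \<open>Am\<close>, so
    from here on \<open>Ap\<close> alone separates the two measures.\<close>
  have \<pi>m_null: "emeasure \<pi>m Ap = 0"
  proof -
    have "emeasure \<pi>m Ap \<le> emeasure \<pi>m (UNIV - Am)"
      using assms(5-7) radon_measuresD(2)[OF \<pi>m] by (intro emeasure_mono) auto
    then show ?thesis using assms(9) by simp
  qed
  have h_eq: "h = indicator Ap"
    using assms(13) by (auto simp: indicator_def)
  have h_integral: "(\<integral>z. h z \<partial>\<tau>) = measure \<tau> Ap" if "sets \<tau> = sets borel" for \<tau>
    using that Ap sets_eq_imp_space_eq[OF that] by (simp add: h_eq)
  have plans_integral: "(\<integral>z. h z \<partial>\<tau>) = measure \<tau> Ap" if "\<tau> \<in> plans" for \<tau>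
    using that by (intro h_integral) (auto simp: plans_def constrained_plans_def radon_measures_def)
  note to_plan = admissible_imp_plan[OF \<pi>p \<pi>m Ap assms(8) \<pi>m_null, folded plans_eq]
  note to_pair = plan_imp_admissible[OF \<pi>p \<pi>m Ap assms(8) \<pi>m_null, folded plans_eq]
  \<comment> \<open>This plan, which corresponds to the pair of zero measures, shows that the
    infimum runs over a nonempty set.\<close>
  have "\<pi>p \<in> plans"
    using \<pi>p \<pi>m by (auto simp: plans_eq constrained_plans_def setwise_le_def emeasure_add_measure radon_measuresD)
  have \<pi>: "\<pi> \<in> radon_measures"
    using assms by (auto intro: radon_measures_add_measure)
  have "integrable \<pi> h"
    using Ap radon_measuresD[OF \<pi>] finite_measure.emeasure_finite[of \<pi> Ap]
    by (simp add: h_eq less_top)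
  then obtain \<tau> where \<tau>: "\<tau> \<in> plans" "\<And>\<tau>'. \<tau>' \<in> plans \<Longrightarrow> (\<integral>z. h z \<partial>\<tau>) \<le> (\<integral>z. h z \<partial>\<tau>')"
    using constrained_plan_minimiser_exists[OF \<pi>, of h \<mu>p \<nu>p] \<open>\<pi>p \<in> plans\<close> unfolding plans_def by blast
  \<comment> \<open>The set of values has a least element, so its real infimum is that
    element.\<close>
  have K: "K = (\<integral>z. h z \<partial>\<tau>)"
    unfolding K_def kantorovich_inf_def plans_def[symmetric]
    using \<tau> by (intro cInf_eq_minimum) auto
  have max_attained: "\<exists>\<sigma>p \<sigma>m. admissible \<pi>p \<pi>m (\<sigma>p, \<sigma>m) \<and> measure \<sigma>p UNIV = measure \<pi>p UNIV - K"
    using to_pair[OF \<tau>(1)] plans_integral[OF \<tau>(1)] K by auto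
  have bound: "measure \<sigma>p UNIV \<le> measure \<pi>p UNIV - K" if "admissible \<pi>p \<pi>m (\<sigma>p, \<sigma>m)" for \<sigma>p \<sigma>m
    using to_plan[OF that] \<tau>(2) plans_integral K by fastforce
  have optimal: "optimal_pair \<pi>p \<pi>m (\<sigma>p, \<sigma>m) \<longleftrightarrow>
      kantorovich_optimal h \<mu>p \<nu>p \<pi> (add_measure (diff_measure \<pi>p \<sigma>p) \<sigma>m)"
    if adm: "admissible \<pi>p \<pi>m (\<sigma>p, \<sigma>m)" for \<sigma>p \<sigma>m
  proof -
    \<comment> \<open>Some admissible pair attains the upper bound, so being a maximiser means
      attaining it.\<close>
    have "optimal_pair \<pi>p \<pi>m (\<sigma>p, \<sigma>m) \<longleftrightarrow> measure \<sigma>p UNIV = measure \<pi>p UNIV - K"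
      using adm max_attained bound unfolding optimal_pair_def is_arg_max_def
      by (auto simp: not_less intro: antisym) (metis bound antisym_conv1 not_less)
    \<comment> \<open>By \<open>to_plan\<close> the measure on the right is a plan and its cost is
      \<open>measure \<pi>p UNIV - measure \<sigma>p UNIV\<close>; this equals \<open>K\<close>
      exactly when the bound is attained.\<close>
    also have "\<dots> \<longleftrightarrow> kantorovich_optimal h \<mu>p \<nu>p \<pi> (add_measure (diff_measure \<pi>p \<sigma>p) \<sigma>m)"
      using to_plan[OF adm] plans_integral unfolding kantorovich_optimal_def K_def[symmetric] plans_def[symmetric]
      by auto
    finally show ?thesis .
  qed
  show ?thesis
    using max_attained bound optimal unfolding K_def by blast
qed

end
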